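(* Let $\gamma$ be a simple closed $C^1$ curve in $\mathbb{R}^2$ with period $L>0$ (in the sense defined in the context). Assume that the derivative $\gamma':\mathbb{R}\to\mathbb{R}^2$ is continuous and that $\gamma$ is arc-length parametrized. Let $f(\theta)=x\!\left(\frac{L\theta}{2\pi}\right)$, where $x$ is the first coordinate of $\gamma$. Let $a,b:\mathbb{N}\to\mathbb{R}$ be sequences such that $\sum_{n=1}^\infty n^2(a_n^2+b_n^2)$ converges and $$\int_0^{2\pi} f(\theta)^2\,d\theta=\pi\sum_{n=1}^\infty (a_n^2+b_n^2),\qquad \int_0^{2\pi} f'(\theta)^2\,d\theta=\pi\sum_{n=1}^\infty n^2(a_n^2+b_n^2).$$ Then $$\mathrm{area}(\gamma)\le \frac{L^2}{4\pi}.$$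
   Context: A simple closed $C^1$ curve in $\mathbb{R}^2$ with period $L$ consists of a real number $L>0$ and a continuous map $\gamma:\mathbb{R}\to\mathbb{R}^2$ (Euclidean plane) such that: $\gamma$ has a derivative $\gamma'(t)\in\mathbb{R}^2$ at every $t\in\mathbb{R}$; $\gamma(0)=\gamma(L)$; $\gamma(t+L)=\gamma(t)$ for all $t\in\mathbb{R}$; and $\gamma$ is injective on the open interval $(0,L)$. Continuity of $\gamma'$ is a separate hypothesis. Write $\gamma(t)=(x(t),y(t))$. The curve is arc-length parametrized if $\|\gamma'(t)\|=1$ (Euclidean norm) for all $t\in\mathbb{R}$; in that case $L$ is the total length of the curve over $[0,L]$. The (signed) area of $\gamma$ is $$\mathrm{area}(\gamma)=\frac12\int_0^L\bigl(x(t)y'(t)-y(t)x'(t)\bigr)\,dt.$$ *)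

theory Defs
  imports "HOL-Analysis.Analysis"
begin

text \<open>
  As in the source, continuity of the derivative is not part of this notion; it is a
  separate hypothesis wherever it is needed.
\<close>

definition simple_closed_C1_curve :: "real \<Rightarrow> (real \<Rightarrow> real ^ 2) \<Rightarrow> bool" where
  "simple_closed_C1_curve L \<gamma> \<longleftrightarrow>
     L > 0 \<and>
     continuous_on UNIV \<gamma> \<and>
     (\<forall>t. \<gamma> differentiable (at t)) \<and>
     \<gamma> 0 = \<gamma> L \<and>
     (\<forall>t. \<gamma> (t + L) = \<gamma> t) \<and>
     inj_on \<gamma> {0<..<L}"

definition arc_length_parametrized :: "(real \<Rightarrow> real ^ 2) \<Rightarrow> bool" where
  "arc_length_parametrized \<gamma> \<longleftrightarrow> (\<forall>t. norm (vector_derivative \<gamma> (at t)) = 1)"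

definition signed_area :: "real \<Rightarrow> (real \<Rightarrow> real ^ 2) \<Rightarrow> real" where
  "signed_area L \<gamma> =
     1 / 2 * integral {0..L}
       (\<lambda>t. \<gamma> t $ 1 * vector_derivative \<gamma> (at t) $ 2 - \<gamma> t $ 2 * vector_derivative \<gamma> (at t) $ 1)"

end

theory Submission
  imports Defs
begin

text \<open>
  This is Hurwitz's proof of the isoperimetric inequality, with the Fourier series of the first
  coordinate entering only through the two Parseval identities. Write \<open>\<gamma> = (x, y)\<close> and
  \<open>r = L / (2 * pi)\<close>, the radius of the circle of length \<open>L\<close>.

  All frequencies in the series are at least 1, so differentiating \<open>f\<close> can only increase its
  squared norm. Rescaled to \<open>{0..L}\<close> this is Wirtinger's inequality: the integral of \<open>x\<^sup>2\<close> is at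
  most \<open>r\<^sup>2\<close> times the integral of \<open>x'\<^sup>2\<close> (lemma \<open>wirtinger_of_parseval\<close>).

  The curve is closed, so \<open>(x y)'\<close> has integral zero and the signed area is the integral of
  \<open>x y'\<close>. Now \<open>2 x y' \<le> x\<^sup>2 / r + r y'\<^sup>2\<close>, and Wirtinger's inequality turns the integral of the
  right-hand side into at most \<open>r\<close> times the integral of \<open>x'\<^sup>2 + y'\<^sup>2\<close>, which is \<open>r L\<close> by unit
  speed. Hence the area is at most \<open>r L / 2 = L\<^sup>2 / (4 * pi)\<close>
  (lemma \<open>signed_area_le_of_wirtinger\<close>).
\<close>

lemma integral_rescale:
  fixes h :: "real \<Rightarrow> real"
  assumes "m > 0" and "continuous_on UNIV h"
  shows "integral {0..T} (\<lambda>t. h (m * t)) = integral {0..m * T} h / m"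
proof -
  have "(h has_integral integral {0..m * T} h) {0..m * T}"
    using assms(2)
    by (intro integrable_integral integrable_continuous_interval) (rule continuous_on_subset, auto)
  from has_integral_stretch_real[OF this, of m]
  have "((\<lambda>t. h (m * t)) has_integral integral {0..m * T} h / m) ((\<lambda>t. t / m) ` {0..m * T})"
    using assms(1) by simp
  moreover have "(\<lambda>t. t / m) ` {0..m * T} = {0..T}"
  proof -
    have "t \<in> (\<lambda>t. t / m) ` {0..m * T}" if "t \<in> {0..T}" for t
      using that assms(1) by (intro image_eqI[of _ _ "m * t"]) auto
    then show ?thesis
      using assms(1) by (auto simp: field_simps)
  qed
  ultimately show ?thesis
    by (simp add: integral_unique)
qed

lemma suminf_le_suminf_frequency_weighted:
  fixes c :: "nat \<Rightarrow> real"
  assumes nonneg: "\<And>n. c n \<ge> 0"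
    and summ: "summable (\<lambda>n. (real (Suc n))\<^sup>2 * c n)"
  shows "(\<Sum>n. c n) \<le> (\<Sum>n. (real (Suc n))\<^sup>2 * c n)"
proof -
  have le: "c n \<le> (real (Suc n))\<^sup>2 * c n" for n
  proof -
    have "1 \<le> (real (Suc n))\<^sup>2"
      by (rule one_le_power) simp
    from mult_right_mono[OF this nonneg[of n]] show ?thesis by simp
  qed
  have "summable c"
    by (rule summable_comparison_test'[OF summ, of 0]) (use le nonneg in auto)
  with le summ show ?thesis
    by (intro suminf_le)
qed

text \<open>
  Both integrals over a full turn are \<open>pi\<close> times sums of the same squared coefficients, the one
  for the derivative carrying weights at least 1. The factor \<open>r\<^sup>2\<close> is what the chain rule
  contributes when the circle of circumference \<open>2 * pi\<close> is stretched to length \<open>2 * pi * r\<close>.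
\<close>

lemma wirtinger_of_parseval:
  fixes x x' :: "real \<Rightarrow> real" and c :: "nat \<Rightarrow> real"
  assumes r: "r > 0"
    and dx: "\<And>t. (x has_real_derivative x' t) (at t)"
    and cx': "continuous_on UNIV x'"
    and nonneg: "\<And>n. c n \<ge> 0"
    and summ: "summable (\<lambda>n. (real (Suc n))\<^sup>2 * c n)"
    and parseval: "integral {0..2 * pi} (\<lambda>\<theta>. (x (r * \<theta>))\<^sup>2) = pi * (\<Sum>n. c n)"
    and parseval': "integral {0..2 * pi} (\<lambda>\<theta>. (deriv (\<lambda>\<theta>. x (r * \<theta>)) \<theta>)\<^sup>2) =
          pi * (\<Sum>n. (real (Suc n))\<^sup>2 * c n)"
  shows "integral {0..r * (2 * pi)} (\<lambda>t. (x t)\<^sup>2)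
         \<le> r\<^sup>2 * integral {0..r * (2 * pi)} (\<lambda>t. (x' t)\<^sup>2)"
proof -
  have cx: "continuous_on UNIV x"
    using dx by (intro continuous_at_imp_continuous_on) (auto intro: DERIV_isCont)
  have "((\<lambda>\<theta>. x (r * \<theta>)) has_real_derivative r * x' (r * \<theta>)) (at \<theta>)" for \<theta>
    using DERIV_chain2[where f = x and g = "\<lambda>\<theta>. r * \<theta>", OF dx DERIV_cmult_Id]
    by (simp add: mult.commute)
  then have "deriv (\<lambda>\<theta>. x (r * \<theta>)) \<theta> = r * x' (r * \<theta>)" for \<theta>
    by (rule DERIV_imp_deriv)
  then have "integral {0..2 * pi} (\<lambda>\<theta>. (x (r * \<theta>))\<^sup>2)
      \<le> integral {0..2 * pi} (\<lambda>\<theta>. (r * x' (r * \<theta>))\<^sup>2)"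
    using suminf_le_suminf_frequency_weighted[OF nonneg summ] parseval parseval' by simp
  then have "integral {0..r * (2 * pi)} (\<lambda>t. (x t)\<^sup>2) / r
      \<le> integral {0..r * (2 * pi)} (\<lambda>t. (r * x' t)\<^sup>2) / r"
    using integral_rescale[OF r, of "\<lambda>t. (x t)\<^sup>2" "2 * pi"]
      integral_rescale[OF r, of "\<lambda>t. (r * x' t)\<^sup>2" "2 * pi"] cx cx'
    by (simp add: continuous_intros)
  then show ?thesis
    using r by (simp add: divide_le_cancel power_mult_distrib)
qed

text \<open>
  The constant \<open>r\<close> in the weighted inequality \<open>2 x y' \<le> x\<^sup>2 / r + r y'\<^sup>2\<close> is chosen so that
  Wirtinger's inequality leaves equal weights on \<open>x'\<^sup>2\<close> and \<open>y'\<^sup>2\<close>, whose sum is known.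
\<close>

lemma signed_area_le_of_wirtinger:
  fixes x y x' y' :: "real \<Rightarrow> real"
  assumes r: "r > 0" and L: "L \<ge> 0"
    and dx: "\<And>t. (x has_real_derivative x' t) (at t)"
    and dy: "\<And>t. (y has_real_derivative y' t) (at t)"
    and cx': "continuous_on UNIV x'" and cy': "continuous_on UNIV y'"
    and closed: "x 0 = x L" "y 0 = y L"
    and speed: "\<And>t. (x' t)\<^sup>2 + (y' t)\<^sup>2 = 1"
    and wirtinger: "integral {0..L} (\<lambda>t. (x t)\<^sup>2) \<le> r\<^sup>2 * integral {0..L} (\<lambda>t. (x' t)\<^sup>2)"
  shows "1 / 2 * integral {0..L} (\<lambda>t. x t * y' t - y t * x' t) \<le> r * L / 2"
proof -
  have cx: "continuous_on UNIV x" and cy: "continuous_on UNIV y"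
    using dx dy by (auto intro!: continuous_at_imp_continuous_on intro: DERIV_isCont)
  have int: "h integrable_on {0..L}" if "continuous_on UNIV h" for h :: "real \<Rightarrow> real"
    using that by (intro integrable_continuous_interval) (rule continuous_on_subset, auto)
  note ints = int continuous_intros cx cy cx' cy'
  have "((\<lambda>t. x t * y' t + y t * x' t) has_integral (x L * y L - x 0 * y 0)) {0..L}"
  proof (rule fundamental_theorem_of_calculus[OF L])
    fix t
    have "((\<lambda>t. x t * y t) has_real_derivative x t * y' t + y t * x' t) (at t)"
      using DERIV_mult[OF dx dy, of t] by (simp add: algebra_simps)
    then show "((\<lambda>t. x t * y t) has_vector_derivative x t * y' t + y t * x' t)
        (at t within {0..L})"
      by (simp add: has_real_derivative_iff_has_vector_derivative has_vector_derivative_at_within)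
  qed
  then have "integral {0..L} (\<lambda>t. x t * y' t + y t * x' t) = 0"
    using closed by (simp add: integral_unique)
  then have parts: "integral {0..L} (\<lambda>t. x t * y' t) + integral {0..L} (\<lambda>t. y t * x' t) = 0"
    by (subst (asm) Henstock_Kurzweil_Integration.integral_add) (intro ints | assumption)+
  have "integral {0..L} (\<lambda>t. x t * y' t - y t * x' t)
      = integral {0..L} (\<lambda>t. x t * y' t) - integral {0..L} (\<lambda>t. y t * x' t)"
    by (intro Henstock_Kurzweil_Integration.integral_diff ints)
  also have "\<dots> = 2 * integral {0..L} (\<lambda>t. x t * y' t)"
    using parts by simp
  also have "\<dots> = integral {0..L} (\<lambda>t. 2 * (x t * y' t))"
    by simp
  also have "\<dots> \<le> integral {0..L} (\<lambda>t. 1 / r * (x t)\<^sup>2 + r * (y' t)\<^sup>2)"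
  proof (intro integral_le ints)
    fix t
    have "0 \<le> (x t - r * y' t)\<^sup>2 / r"
      using r by simp
    also have "\<dots> = 1 / r * (x t)\<^sup>2 + r * (y' t)\<^sup>2 - 2 * (x t * y' t)"
      using r by (simp add: power2_eq_square field_simps)
    finally show "2 * (x t * y' t) \<le> 1 / r * (x t)\<^sup>2 + r * (y' t)\<^sup>2"
      by simp
  qed
  also have "\<dots> = 1 / r * integral {0..L} (\<lambda>t. (x t)\<^sup>2) + r * integral {0..L} (\<lambda>t. (y' t)\<^sup>2)"
    by (subst Henstock_Kurzweil_Integration.integral_add) (intro ints | simp)+
  also have "\<dots> \<le> r * integral {0..L} (\<lambda>t. (x' t)\<^sup>2) + r * integral {0..L} (\<lambda>t. (y' t)\<^sup>2)"
    using r wirtinger by (simp add: field_simps power2_eq_square)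
  also have "\<dots> = r * integral {0..L} (\<lambda>t. (x' t)\<^sup>2 + (y' t)\<^sup>2)"
    by (subst Henstock_Kurzweil_Integration.integral_add) (intro ints | simp add: algebra_simps)+
  also have "\<dots> = r * L"
    using L by (simp add: speed)
  finally show ?thesis
    by simp
qed

theorem theorem7p5:
  fixes L :: real and \<gamma> :: "real \<Rightarrow> real ^ 2"
    and f :: "real \<Rightarrow> real" and a b :: "nat \<Rightarrow> real"
  assumes "simple_closed_C1_curve L \<gamma>"
    and "continuous_on UNIV (\<lambda>t. vector_derivative \<gamma> (at t))"
    and "arc_length_parametrized \<gamma>"
    and "f = (\<lambda>\<theta>. \<gamma> (L * \<theta> / (2 * pi)) $ 1)"
    and "summable (\<lambda>n. (real (Suc n))\<^sup>2 * ((a (Suc n))\<^sup>2 + (b (Suc n))\<^sup>2))"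
    and "integral {0..2 * pi} (\<lambda>\<theta>. (f \<theta>)\<^sup>2) =
           pi * (\<Sum>n. (a (Suc n))\<^sup>2 + (b (Suc n))\<^sup>2)"
    and "integral {0..2 * pi} (\<lambda>\<theta>. (deriv f \<theta>)\<^sup>2) =
           pi * (\<Sum>n. (real (Suc n))\<^sup>2 * ((a (Suc n))\<^sup>2 + (b (Suc n))\<^sup>2))"
  shows "signed_area L \<gamma> \<le> L\<^sup>2 / (4 * pi)"
proof -
  let ?\<gamma>' = "\<lambda>t. vector_derivative \<gamma> (at t)"
  let ?r = "L / (2 * pi)"
  have L: "L > 0" and diff: "\<And>t. \<gamma> differentiable (at t)" and closed: "\<gamma> 0 = \<gamma> L"
    using assms(1) by (auto simp: simple_closed_C1_curve_def)
  have r: "?r > 0"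
    using L by simp
  have comp_deriv: "((\<lambda>t. \<gamma> t $ i) has_real_derivative ?\<gamma>' t $ i) (at t)" for i t
    using bounded_linear.has_vector_derivative[OF bounded_linear_vec_nth
        diff[of t, unfolded vector_derivative_works]]
    by (simp add: has_real_derivative_iff_has_vector_derivative)
  have comp_cont: "continuous_on UNIV (\<lambda>t. ?\<gamma>' t $ i)" for i
    by (intro continuous_intros assms(2))
  have speed: "(?\<gamma>' t $ 1)\<^sup>2 + (?\<gamma>' t $ 2)\<^sup>2 = 1" for t
  proof -
    have "(norm (?\<gamma>' t))\<^sup>2 = 1"
      using assms(3) by (simp add: arc_length_parametrized_def)
    then show ?thesis
      unfolding power2_norm_eq_inner by (simp add: inner_vec_def sum_2 power2_eq_square)
  qed
  have f: "f = (\<lambda>\<theta>. \<gamma> (?r * \<theta>) $ 1)"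
    by (simp add: assms(4))
  have "integral {0..?r * (2 * pi)} (\<lambda>t. (\<gamma> t $ 1)\<^sup>2)
      \<le> ?r\<^sup>2 * integral {0..?r * (2 * pi)} (\<lambda>t. (?\<gamma>' t $ 1)\<^sup>2)"
    by (rule wirtinger_of_parseval[OF r comp_deriv comp_cont _ assms(5)
          assms(6)[unfolded f] assms(7)[unfolded f]]) simp
  then have "integral {0..L} (\<lambda>t. (\<gamma> t $ 1)\<^sup>2) \<le> ?r\<^sup>2 * integral {0..L} (\<lambda>t. (?\<gamma>' t $ 1)\<^sup>2)"
    by simp
  from signed_area_le_of_wirtinger[OF r less_imp_le[OF L] comp_deriv comp_deriv comp_cont
      comp_cont _ _ speed this]
  have "signed_area L \<gamma> \<le> ?r * L / 2"
    using closed by (simp add: signed_area_def)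
  then show ?thesis
    by (simp add: power2_eq_square)
qed

end
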